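(* Let $Q\subset\mathbb{R}^d_{\ge 0}\setminus\{\mathbf{0}\}$ be a polytope, let $q\ge 1$, let $f$ be $q$-homogeneous and convex on $\operatorname{conv}(Q\cup\{\mathbf{0}\})$, and let $\mu$ be a concave upper bound of $f$ on $Q$. Let $P=P(f,Q)$ and $P^0=P^0(f,Q)$ be the perspective and naïve relaxations (both defined using $\mu$), and let $\Delta(P^0,P):=\operatorname{vol}(P^0)-\operatorname{vol}(P)$. Then $$\Delta(P^0,P)=\frac{q-1}{(d+2)(q+d+1)}\int_Q f(\mathbf{x})\,d\mathbf{x}.$$
   Context: $f$ is $q$-homogeneous if $f(\lambda\mathbf{x})=\lambda^q f(\mathbf{x})$ for all $\lambda\ge 0$ (whenever $\mathbf{x}$ and $\lambda\mathbf{x}$ lie in the domain of $f$); in particular $f(\mathbf{0})=0$. A concave upper bound of $f$ on $Q$ is a concave function $\mu:Q\to\mathbb{R}$ with $\mu(\mathbf{x})\ge f(\mathbf{x})$ for all $\mathbf{x}\in Q$. For $z>0$ and $\mathbf{x}\in z\cdot Q=\{z\mathbf{q}:\mathbf{q}\in Q\}$ write $\tilde f(\mathbf{x},z):=z f(\mathbf{x}/z)$ and $\tilde\mu(\mathbf{x},z):=z\mu(\mathbf{x}/z)$, and (closure convention) $\tilde\mu(\mathbf{0},0):=0$. The perspective relaxation is $$P(f,Q):=\operatorname{convcl}\{(\mathbf{x},y,z)\in\mathbb{R}^d\times\mathbb{R}\times\mathbb{R}:\ \tilde\mu(\mathbf{x},z)\ge y\ge\tilde f(\mathbf{x},z),\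 \mathbf{x}\in z\cdot Q,\ 1\ge z>0\},$$ where $\operatorname{convcl}$ denotes the closure of the convex hull, and the naïve relaxation is $$P^0(f,Q):=\{(\mathbf{x},y,z)\in\mathbb{R}^d\times\mathbb{R}\times\mathbb{R}:\ \tilde\mu(\mathbf{x},z)\ge y\ge f(\mathbf{x}),\ \mathbf{x}\in z\cdot Q,\ 1\ge z\ge 0\}.$$ $\operatorname{vol}$ denotes Lebesgue measure in $\mathbb{R}^{d+2}$, and integrals over $Q$ are with respect to Lebesgue measure in $\mathbb{R}^d$. *)

theory Defs
  imports "HOL-Analysis.Analysis"
begin

text \<open>For exponents \<open>q > 0\<close>, \<open>0 powr q = 0\<close>, so \<open>homogeneous_on S q f\<close> forces \<open>f 0 = 0\<close>
  whenever \<open>0 \<in> S\<close>.\<close>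

definition homogeneous_on :: "'a::real_vector set \<Rightarrow> real \<Rightarrow> ('a \<Rightarrow> real) \<Rightarrow> bool"
  where "homogeneous_on S q f \<longleftrightarrow>
    (\<forall>x\<in>S. \<forall>l\<ge>0. l *\<^sub>R x \<in> S \<longrightarrow> f (l *\<^sub>R x) = l powr q * f x)"

definition concave_upper_bound :: "'a::real_vector set \<Rightarrow> ('a \<Rightarrow> real) \<Rightarrow> ('a \<Rightarrow> real) \<Rightarrow> bool"
  where "concave_upper_bound Q f \<mu> \<longleftrightarrow> concave_on Q \<mu> \<and> (\<forall>x\<in>Q. f x \<le> \<mu> x)"

text \<open>The case \<open>z = 0\<close> encodes the closure convention at the origin. It is only ever used at
  \<open>x = 0\<close>, since below \<open>x\<close> ranges over \<open>z \<cdot> Q\<close>.\<close>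

definition perspective :: "('a::real_vector \<Rightarrow> real) \<Rightarrow> 'a \<Rightarrow> real \<Rightarrow> real"
  where "perspective g x z = (if z = 0 then 0 else z * g (x /\<^sub>R z))"

definition perspective_relaxation ::
    "('a::euclidean_space \<Rightarrow> real) \<Rightarrow> ('a \<Rightarrow> real) \<Rightarrow> 'a set \<Rightarrow> ('a \<times> real \<times> real) set"
  where "perspective_relaxation f \<mu> Q = closure (convex hull
    {(x, y, z). perspective \<mu> x z \<ge> y \<and> y \<ge> perspective f x z \<and>
                x \<in> (*\<^sub>R) z ` Q \<and> 1 \<ge> z \<and> z > 0})"

definition naive_relaxation ::
    "('a::euclidean_space \<Rightarrow> real) \<Rightarrow> ('a \<Rightarrow> real) \<Rightarrow> 'a set \<Rightarrow> ('a \<times> real \<times> real) set"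
  where "naive_relaxation f \<mu> Q =
    {(x, y, z). perspective \<mu> x z \<ge> y \<and> y \<ge> f x \<and>
                x \<in> (*\<^sub>R) z ` Q \<and> 1 \<ge> z \<and> z \<ge> 0}"

text \<open>The completion \<open>lebesgue\<close> is used instead of \<open>lborel\<close>: \<open>\<mu>\<close> may be
  badly behaved on the relative boundary of \<open>Q\<close>, so the naive relaxation need not be Borel.\<close>

definition vol_difference :: "'a::euclidean_space set \<Rightarrow> 'a set \<Rightarrow> real"
  where "vol_difference A B = measure lebesgue A - measure lebesgue B"

end

theory Submission
  imports Defs
begin

text \<open>Write \<open>d\<close> for the dimension and let \<open>C\<close> be the set whose closed convex hull is the
  perspective relaxation. The perspective of a convex function is convex
  (\<open>convex_perspective_epigraph\<close>), so \<open>C\<close> is already convex. It is bounded because convex and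
  concave functions on a polytope are bounded (\<open>convex_on_polytope_bounded\<close>). The frontier of a
  convex set is negligible, so the closure of \<open>C\<close> has the same volume as \<open>C\<close>.

  A point of the naive relaxation with \<open>z > 0\<close> has the form \<open>(z u, y, z)\<close> with \<open>u \<in> Q\<close> and
  \<open>z powr q * f u \<le> y \<le> z * \<mu> u\<close>; it lies in \<open>C\<close> exactly if \<open>z * f u \<le> y\<close>. Convexity on the
  segment from the origin gives \<open>z powr q * f u \<le> z * f u\<close>. Hence, up to null sets, the naive
  relaxation is the disjoint union of \<open>C\<close> and the gap
  \<open>D = {(z u, y, z). 0 < z \<le> 1, u \<in> interior Q, z powr q * f u \<le> y < z * f u}\<close>,
  in which \<open>\<mu>\<close> no longer occurs. Since \<open>f\<close> is continuous on the interior of \<open>Q\<close>, the gap is a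
  Borel set, and integrating first over \<open>y\<close>, then over \<open>x = z u\<close>, then over \<open>z\<close>
  (\<open>emeasure_cone_coordinates\<close>, \<open>measure_perspective_gap\<close>) shows that its volume is the integral
  of \<open>f\<close> over \<open>Q\<close> times the integral of \<open>(z - z powr q) * z ^ d\<close> over \<open>0 < z \<le> 1\<close>, which is
  \<open>1 / (d + 2) - 1 / (q + d + 1)\<close>.\<close>

section \<open>Convex functions on polytopes and their perspectives\<close>

text \<open>The values at the vertices bound \<open>f\<close> from above. The lower bound holds because the barycentre of the
  vertices is a convex combination of any given point of the polytope and the vertices, in
  which the point has a weight independent of it.\<close>

lemma convex_on_polytope_bounded:
  fixes f :: "'a::euclidean_space \<Rightarrow> real"
  assumes "polytope S" "convex_on S f"
  obtains B where "\<And>x. x \<in> S \<Longrightarrow> \<bar>f x\<bar> \<le> B"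
proof (cases "S = {}")
  case True
  then show ?thesis using that[of 0] by simp
next
  case False
  obtain V where V: "finite V" "S = convex hull V"
    using assms(1) unfolding polytope_def by blast
  define n where "n = real (card V)"
  have "V \<noteq> {}" using False V by auto
  then have n: "n \<ge> 1"
    using V(1) by (simp add: n_def Suc_le_eq card_gt_0_iff)
  define c where "c = (\<Sum>v\<in>V. (1/n) *\<^sub>R v)"
  define A where "A = (\<Sum>v\<in>V. \<bar>f v\<bar>)"
  have A: "\<bar>f v\<bar> \<le> A" if "v \<in> V" for v
    unfolding A_def using that V(1) by (intro member_le_sum) auto
  have upper: "f x \<le> A" if "x \<in> S" for x
    using convex_on_convex_hull_bound[of V f A] assms(2) A that V(2)
    by (metis abs_le_D1)
  have lower: "n * f c - A \<le> f x" if "x \<in> S" for x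
  proof -
    obtain u where u: "\<forall>v\<in>V. 0 \<le> u v" "sum u V = 1" "(\<Sum>v\<in>V. u v *\<^sub>R v) = x"
      using \<open>x \<in> S\<close> unfolding V(2) convex_hull_finite[OF V(1)] by blast
    have u1: "u v \<le> 1" if "v \<in> V" for v
      using member_le_sum[of v V u] u V(1) that by auto
    \<comment> \<open>Write \<open>c\<close> with weight \<open>1/n\<close> on \<open>x\<close> and \<open>(1 - u v)/n\<close> on each vertex \<open>v\<close>. The
      index \<open>None\<close> stands for \<open>x\<close>, which may itself be a vertex.\<close>
    define w where "w i = (case i of None \<Rightarrow> 1/n | Some v \<Rightarrow> (1 - u v) / n)" for i
    define p where "p i = (case i of None \<Rightarrow> x | Some v \<Rightarrow> v)" for i
    let ?I = "insert None (Some ` V)"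
    have sum_I: "(\<Sum>i\<in>?I. h i) = h None + (\<Sum>v\<in>V. h (Some v))"
      for h :: "'a option \<Rightarrow> 'b::comm_monoid_add"
      using V(1) by (subst sum.insert) (auto simp: sum.reindex)
    have w1: "sum w ?I = 1"
      using n u(2) unfolding sum_I
      by (simp add: w_def sum_subtractf n_def flip: sum_divide_distrib) (simp add: field_simps)
    have w0: "w i \<ge> 0" if "i \<in> ?I" for i
      using that n u1 by (auto simp: w_def)
    have pS: "p i \<in> S" if "i \<in> ?I" for i
      using that \<open>x \<in> S\<close> V(2) hull_subset[of V convex] by (auto simp: p_def)
    have "(\<Sum>i\<in>?I. w i *\<^sub>R p i) = (1/n) *\<^sub>R x + (\<Sum>v\<in>V. (1/n) *\<^sub>R v - (1/n) *\<^sub>R (u v *\<^sub>R v))"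
      unfolding sum_I by (simp add: w_def p_def diff_divide_distrib scaleR_diff_left)
    also have "\<dots> = c"
      unfolding sum_subtractf scaleR_sum_right[symmetric] u(3) by (simp add: c_def scaleR_sum_right)
    finally have c_eq: "(\<Sum>i\<in>?I. w i *\<^sub>R p i) = c" .
    have "f c \<le> (\<Sum>i\<in>?I. w i * f (p i))"
      unfolding c_eq[symmetric]
      by (rule convex_on_sum[OF _ _ assms(2) w1 w0 pS]) (use V(1) in auto)
    also have "\<dots> = f x / n + (\<Sum>v\<in>V. (1 - u v) / n * f v)"
      unfolding sum_I by (simp add: w_def p_def)
    also have "\<dots> \<le> f x / n + (\<Sum>v\<in>V. \<bar>f v\<bar> / n)"
    proof (intro add_left_mono sum_mono)
      fix v assume "v \<in> V"
      then have "(1 - u v) * f v \<le> (1 - u v) * \<bar>f v\<bar>"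
        using u1[of v] by (intro mult_left_mono) auto
      also have "\<dots> \<le> 1 * \<bar>f v\<bar>"
        using u(1) \<open>v \<in> V\<close> by (intro mult_right_mono) auto
      finally show "(1 - u v) / n * f v \<le> \<bar>f v\<bar> / n"
        using n by (simp add: divide_right_mono)
    qed
    also have "\<dots> = (f x + A) / n"
      by (simp add: A_def add_divide_distrib sum_divide_distrib)
    finally show ?thesis
      using n by (simp add: field_simps)
  qed
  show ?thesis
  proof (rule that[of "\<bar>A\<bar> + \<bar>n * f c - A\<bar>"])
    fix x assume "x \<in> S"
    then show "\<bar>f x\<bar> \<le> \<bar>A\<bar> + \<bar>n * f c - A\<bar>"
      using upper[of x] lower[of x] by linarith
  qed
qed

text \<open>A convex combination of \<open>(z1 a, y1, z1)\<close> and \<open>(z2 b, y2, z2)\<close> with coefficients \<open>u\<close>, \<open>v\<close> has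
  first component \<open>z w\<close>, where \<open>z = u z1 + v z2\<close> and \<open>w\<close> is the convex combination of \<open>a\<close> and \<open>b\<close>
  with weights proportional to \<open>u z1\<close> and \<open>v z2\<close>.\<close>

lemma convex_perspective_epigraph:
  fixes f :: "'a::real_vector \<Rightarrow> real"
  assumes "convex_on Q f"
  shows "convex {(x, y, z). 0 < z \<and> x \<in> (*\<^sub>R) z ` Q \<and> perspective f x z \<le> y}"
  (is "convex ?E")
proof (rule convexI)
  fix p p' :: "'a \<times> real \<times> real" and u v :: real
  assume pE: "p \<in> ?E" "p' \<in> ?E" and uv: "0 \<le> u" "0 \<le> v" "u + v = 1"
  obtain a y1 z1 b y2 z2 where p: "p = (z1 *\<^sub>R a, y1, z1)" "p' = (z2 *\<^sub>R b, y2, z2)"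
    and z: "0 < z1" "0 < z2" and ab: "a \<in> Q" "b \<in> Q"
    and y: "perspective f (z1 *\<^sub>R a) z1 \<le> y1" "perspective f (z2 *\<^sub>R b) z2 \<le> y2"
    using pE by auto
  define z where "z = u * z1 + v * z2"
  have z_pos: "z > 0"
    unfolding z_def using uv z
    by (cases "u = 0") (auto intro: add_pos_nonneg)
  let ?s = "u * z1 / z" and ?t = "v * z2 / z"
  have st: "?s \<ge> 0" "?t \<ge> 0" "?s + ?t = 1"
    using uv z z_pos by (auto simp: z_def simp flip: add_divide_distrib)
  define w where "w = ?s *\<^sub>R a + ?t *\<^sub>R b"
  have w: "w \<in> Q"
    unfolding w_def using convex_on_imp_convex[OF assms] ab st by (auto simp: convex_def)
  have fw: "f w \<le> ?s * f a + ?t * f b"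
    unfolding w_def using assms ab st unfolding convex_on_def by blast
  have zw: "u *\<^sub>R (z1 *\<^sub>R a) + v *\<^sub>R (z2 *\<^sub>R b) = z *\<^sub>R w"
    using z_pos by (simp add: w_def scaleR_right_distrib)
  have "perspective f (z *\<^sub>R w) z = z * f w"
    using z_pos by (simp add: perspective_def)
  also have "\<dots> \<le> z * (?s * f a + ?t * f b)"
    using fw z_pos by simp
  also have "\<dots> = u * (z1 * f a) + v * (z2 * f b)"
    using z_pos by (simp add: field_simps)
  also have "\<dots> \<le> u * y1 + v * y2"
    using y uv z by (intro add_mono mult_left_mono) (auto simp: perspective_def)
  finally have "perspective f (z *\<^sub>R w) z \<le> u * y1 + v * y2" .
  moreover have "u *\<^sub>R p + v *\<^sub>R p' = (z *\<^sub>R w, u * y1 + v * y2, z)"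
    using zw by (simp add: p z_def)
  ultimately show "u *\<^sub>R p + v *\<^sub>R p' \<in> ?E"
    using z_pos w by auto
qed

section \<open>Volume in cone coordinates\<close>

lemma nn_integral_lborel_scaleR:
  fixes h :: "'a::euclidean_space \<Rightarrow> ennreal" and z :: real
  assumes [measurable]: "h \<in> borel_measurable borel" and z: "z > 0"
  shows "(\<integral>\<^sup>+x. h (x /\<^sub>R z) \<partial>lborel) = ennreal (z ^ DIM('a)) * (\<integral>\<^sup>+u. h u \<partial>lborel)"
proof -
  have "(\<integral>\<^sup>+x. h (x /\<^sub>R z) \<partial>lborel) =
      (\<integral>\<^sup>+x. h (x /\<^sub>R z) \<partial>density (distr lborel borel (\<lambda>x::'a. 0 + z *\<^sub>R x)) (\<lambda>_. \<bar>z\<bar> ^ DIM('a)))"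
    using lborel_affine[of z "0::'a"] z by simp
  also have "\<dots> = ennreal (z ^ DIM('a)) * (\<integral>\<^sup>+u. h u \<partial>lborel)"
    using z by (simp add: nn_integral_density nn_integral_distr nn_integral_cmult)
  finally show ?thesis .
qed

text \<open>The slice at height \<open>z\<close> of the measured set is a copy of the slice of \<open>A\<close> with its first
  component scaled by \<open>z\<close>, which accounts for the Jacobian \<open>z ^ DIM('a)\<close>.\<close>

lemma emeasure_cone_coordinates:
  fixes A :: "('a::euclidean_space \<times> real \<times> real) set"
  assumes [measurable]: "A \<in> sets borel"
  shows "{(x, y, z). 0 < z \<and> (x /\<^sub>R z, y, z) \<in> A} \<in> sets borel" (is "?S \<in> _")
    and "emeasure lborel {(x, y, z). 0 < z \<and> (x /\<^sub>R z, y, z) \<in> A} =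
      (\<integral>\<^sup>+z. indicator {0<..} z * (ennreal (z ^ DIM('a)) *
        (\<integral>\<^sup>+u. emeasure lborel {y. (u, y, z) \<in> A} \<partial>lborel)) \<partial>lborel)"
proof -
  have A [measurable]: "A \<in> sets (borel \<Otimes>\<^sub>M borel \<Otimes>\<^sub>M borel)"
    using assms by (simp only: borel_prod)
  have "{p \<in> space (borel \<Otimes>\<^sub>M borel \<Otimes>\<^sub>M borel :: ('a \<times> real \<times> real) measure).
      0 < snd (snd p) \<and> (fst p /\<^sub>R snd (snd p), fst (snd p), snd (snd p)) \<in> A}
      \<in> sets (borel \<Otimes>\<^sub>M borel \<Otimes>\<^sub>M borel)"
    by measurable
  also have "{p \<in> space (borel \<Otimes>\<^sub>M borel \<Otimes>\<^sub>M borel :: ('a \<times> real \<times> real) measure).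
      0 < snd (snd p) \<and> (fst p /\<^sub>R snd (snd p), fst (snd p), snd (snd p)) \<in> A} = ?S"
    by (auto simp: space_pair_measure)
  finally have S [measurable]: "?S \<in> sets (borel \<Otimes>\<^sub>M borel \<Otimes>\<^sub>M borel)" .
  then show S': "?S \<in> sets borel"
    by (simp only: borel_prod)
  have "emeasure lborel ?S = (\<integral>\<^sup>+p. indicator ?S p \<partial>(lborel \<Otimes>\<^sub>M lborel))"
    using S' by (simp add: lborel_prod)
  also have "\<dots> = (\<integral>\<^sup>+x. \<integral>\<^sup>+w. indicator ?S (x, w) \<partial>(lborel \<Otimes>\<^sub>M lborel) \<partial>lborel)"
    unfolding lborel_prod
    by (subst lborel.nn_integral_fst) (simp_all add: borel_measurable_indicator S' lborel_prod)
  also have "\<dots> = (\<integral>\<^sup>+x. \<integral>\<^sup>+z. \<integral>\<^sup>+y. indicator ?S (x, y, z) \<partial>lborel \<partial>lborel \<partial>lborel)"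
    by (intro nn_integral_cong, subst lborel_pair.nn_integral_snd[symmetric]) simp_all
  also have "\<dots> = (\<integral>\<^sup>+z. \<integral>\<^sup>+x. \<integral>\<^sup>+y. indicator ?S (x, y, z) \<partial>lborel \<partial>lborel \<partial>lborel)"
    by (subst lborel_pair.Fubini') simp_all
  also have "\<dots> = (\<integral>\<^sup>+z. indicator {0<..} z * (\<integral>\<^sup>+x. \<integral>\<^sup>+y. indicator A (x /\<^sub>R z, y, z) \<partial>lborel \<partial>lborel) \<partial>lborel)"
    by (intro nn_integral_cong) (auto simp: indicator_def)
  also have "\<dots> = (\<integral>\<^sup>+z. indicator {0<..} z * (ennreal (z ^ DIM('a)) *
        (\<integral>\<^sup>+u. emeasure lborel {y. (u, y, z) \<in> A} \<partial>lborel)) \<partial>lborel)"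
  proof (intro nn_integral_cong)
    fix z :: real
    have "(\<integral>\<^sup>+y. indicator A (u, y, z) \<partial>lborel) = emeasure lborel {y. (u, y, z) \<in> A}" for u
    proof -
      have "{y \<in> space borel. (u, y, z) \<in> A} \<in> sets borel" by measurable
      then have "emeasure lborel {y. (u, y, z) \<in> A} = (\<integral>\<^sup>+y. indicator {y. (u, y, z) \<in> A} y \<partial>lborel)"
        by simp
      then show ?thesis by (simp add: indicator_def)
    qed
    then show "indicator {0<..} z * (\<integral>\<^sup>+x. \<integral>\<^sup>+y. indicator A (x /\<^sub>R z, y, z) \<partial>lborel \<partial>lborel) =
       indicator {0<..} z * (ennreal (z ^ DIM('a)) *
        (\<integral>\<^sup>+u. emeasure lborel {y. (u, y, z) \<in> A} \<partial>lborel))"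
      using nn_integral_lborel_scaleR[of "\<lambda>u. \<integral>\<^sup>+y. indicator A (u, y, z) \<partial>lborel" z]
      by (auto simp: indicator_def)
  qed
  finally show "emeasure lborel ?S = \<dots>" .
qed

lemma negligible_cone_over:
  fixes N :: "'a::euclidean_space set"
  assumes "closed N" "negligible N"
  shows "negligible {(x, y::real, z::real). 0 < z \<and> x /\<^sub>R z \<in> N}"
proof -
  have N: "N \<times> UNIV \<in> sets (borel :: ('a \<times> real \<times> real) measure)"
    using assms(1) by (intro borel_closed closed_Times) auto
  have N0: "emeasure lborel N = 0"
    using assms by (simp add: negligible_iff_emeasure0)
  have inner: "(\<integral>\<^sup>+u. emeasure lborel {y::real. (u, y, z) \<in> N \<times> UNIV} \<partial>lborel) = 0" for z :: real
  proof -
    have "(\<integral>\<^sup>+u. emeasure lborel {y::real. (u, y, z) \<in> N \<times> UNIV} \<partial>lborel)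
        = (\<integral>\<^sup>+u. \<infinity> * indicator N u \<partial>lborel)"
      by (intro nn_integral_cong) (auto simp: indicator_def)
    also have "\<dots> = 0"
      using N0 assms(1) by (subst nn_integral_cmult_indicator) auto
    finally show ?thesis .
  qed
  note c = emeasure_cone_coordinates[OF N]
  have "emeasure lborel {(x, y::real, z::real). 0 < z \<and> (x /\<^sub>R z, y, z) \<in> N \<times> UNIV} = 0"
    unfolding c(2) inner by simp
  then have "{(x, y::real, z::real). 0 < z \<and> (x /\<^sub>R z, y, z) \<in> N \<times> UNIV} \<in> null_sets lborel"
    using c(1) by (intro null_setsI) auto
  then show ?thesis
    by (simp add: negligible_iff_null_sets null_sets_completionI)
qed

lemma nn_integral_gap_weight:
  fixes q :: real
  assumes "q \<ge> 1"
  shows "(\<integral>\<^sup>+z. ennreal (indicator {0<..1} z * ((z - z powr q) * z ^ n)) \<partial>lborel) =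
    ennreal ((q - 1) / ((real n + 2) * (q + real n + 1)))"
proof (rule nn_integral_has_integral_lborel)
  have le: "z powr q \<le> z" if "0 < z" "z \<le> 1" for z
    using powr_mono'[of 1 q z] that assms by simp
  show "0 \<le> indicator {0<..1} z * ((z - z powr q) * z ^ n)" for z
    using le[of z] by (auto simp: indicator_def)
  have "((\<lambda>z. z powr (real n + 1) - z powr (q + real n)) has_integral
      (1 powr (real n + 1 + 1) / (real n + 1 + 1) - 1 powr (q + real n + 1) / (q + real n + 1))) {0..1}"
    using assms by (intro has_integral_diff has_integral_powr_from_0) auto
  also have "1 powr (real n + 1 + 1) / (real n + 1 + 1) - 1 powr (q + real n + 1) / (q + real n + 1)
      = (q - 1) / ((real n + 2) * (q + real n + 1))"
    using assms by (simp add: field_simps)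
  finally have "((\<lambda>z. if z \<in> {0..1} then z powr (real n + 1) - z powr (q + real n) else 0) has_integral
      (q - 1) / ((real n + 2) * (q + real n + 1))) UNIV"
    by (simp only: has_integral_restrict_UNIV)
  moreover have "(\<lambda>z. if z \<in> {0..1} then z powr (real n + 1) - z powr (q + real n) else 0)
      = (\<lambda>z. indicator {0<..1} z * ((z - z powr q) * z ^ n))"
  proof
    fix z :: real
    show "(if z \<in> {0..1} then z powr (real n + 1) - z powr (q + real n) else 0)
      = indicator {0<..1} z * ((z - z powr q) * z ^ n)"
      using powr_realpow[of z n]
      by (cases "z = 0") (auto simp: indicator_def powr_add algebra_simps)
  qed
  ultimately show "((\<lambda>z. indicator {0<..1} z * ((z - z powr q) * z ^ n)) has_integral
      (q - 1) / ((real n + 2) * (q + real n + 1))) UNIV"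
    by simp
qed measurable

text \<open>With \<open>u = x /\<^sub>R z\<close> and \<open>z\<close> fixed, the values \<open>y\<close> fill an interval of length
  \<open>(z - z powr q) * g u\<close>. For \<open>q = 1\<close> this interval is always empty, so that the sign of \<open>g\<close> does
  not matter.\<close>

lemma measure_perspective_gap:
  fixes g :: "'a::euclidean_space \<Rightarrow> real"
  assumes [measurable]: "g \<in> borel_measurable borel" and int: "integrable lborel g"
    and q: "q \<ge> 1" and g: "q > 1 \<Longrightarrow> (\<And>u. 0 \<le> g u)"
  defines "D \<equiv> {(x, y, z). 0 < z \<and> z \<le> 1 \<and> z powr q * g (x /\<^sub>R z) \<le> y \<and> y < z * g (x /\<^sub>R z)}"
  shows "D \<in> sets borel"
    and "measure lborel D =
      (q - 1) / ((real DIM('a) + 2) * (q + real DIM('a) + 1)) * integral\<^sup>L lborel g"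
proof -
  define A where "A = {(u, y, z). z \<le> 1 \<and> z powr q * g u \<le> y \<and> y < z * g u}"
  define K where "K = (q - 1) / ((real DIM('a) + 2) * (q + real DIM('a) + 1))"
  have "{p \<in> space (borel \<Otimes>\<^sub>M borel \<Otimes>\<^sub>M borel :: ('a \<times> real \<times> real) measure).
      snd (snd p) \<le> 1 \<and> snd (snd p) powr q * g (fst p) \<le> fst (snd p) \<and>
      fst (snd p) < snd (snd p) * g (fst p)} \<in> sets (borel \<Otimes>\<^sub>M borel \<Otimes>\<^sub>M borel)"
    by measurable
  also have "{p \<in> space (borel \<Otimes>\<^sub>M borel \<Otimes>\<^sub>M borel :: ('a \<times> real \<times> real) measure).
      snd (snd p) \<le> 1 \<and> snd (snd p) powr q * g (fst p) \<le> fst (snd p) \<and>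
      fst (snd p) < snd (snd p) * g (fst p)} = A"
    by (auto simp: A_def space_pair_measure)
  finally have A: "A \<in> sets borel"
    by (simp only: borel_prod)
  have D: "D = {(x, y, z). 0 < z \<and> (x /\<^sub>R z, y, z) \<in> A}"
    by (auto simp: D_def A_def)
  show "D \<in> sets borel"
    unfolding D by (rule emeasure_cone_coordinates(1)[OF A])
  have le: "z powr q \<le> z" if "0 < z" "z \<le> 1" for z
    using powr_mono'[of 1 q z] that q by simp
  have slice: "indicator {0<..} z * (ennreal (z ^ DIM('a)) *
        (\<integral>\<^sup>+u. emeasure lborel {y. (u, y, z) \<in> A} \<partial>lborel))
      = ennreal (indicator {0<..1} z * ((z - z powr q) * z ^ DIM('a))) * (\<integral>\<^sup>+u. ennreal (g u) \<partial>lborel)"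
    (is "?lhs = ?rhs") for z
  proof (cases "0 < z \<and> z \<le> 1")
    case True
    have "emeasure lborel {y. (u, y, z) \<in> A} = ennreal (z - z powr q) * ennreal (g u)" for u
    proof -
      have "{y. (u, y, z) \<in> A} = {z powr q * g u..<z * g u}"
        using True by (auto simp: A_def)
      then have "emeasure lborel {y. (u, y, z) \<in> A} = ennreal (z * g u - z powr q * g u)"
        by (cases "z powr q * g u \<le> z * g u") (auto simp: ennreal_neg)
      also have "z * g u - z powr q * g u = (z - z powr q) * g u"
        by (simp add: algebra_simps)
      also have "ennreal \<dots> = ennreal (z - z powr q) * ennreal (g u)"
        using le[of z] True by (intro ennreal_mult') auto
      finally show ?thesis .
    qed
    then have "(\<integral>\<^sup>+u. emeasure lborel {y. (u, y, z) \<in> A} \<partial>lborel)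
        = ennreal (z - z powr q) * (\<integral>\<^sup>+u. ennreal (g u) \<partial>lborel)"
      by (simp only: nn_integral_cmult) (rule nn_integral_cmult, measurable)
    then show ?thesis
      using True le[of z] by (simp add: ennreal_mult ac_simps)
  next
    case False
    have "{y. (u, y, z) \<in> A} = {}" if "z > 1" for u
      using that by (auto simp: A_def)
    with False show ?thesis
      by (cases "z > 1") (auto simp: indicator_def)
  qed
  have "emeasure lborel D = (\<integral>\<^sup>+z. ennreal (indicator {0<..1} z * ((z - z powr q) * z ^ DIM('a))) *
      (\<integral>\<^sup>+u. ennreal (g u) \<partial>lborel) \<partial>lborel)"
    unfolding D emeasure_cone_coordinates(2)[OF A] slice ..
  also have "\<dots> = ennreal K * (\<integral>\<^sup>+u. ennreal (g u) \<partial>lborel)"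
    by (subst nn_integral_multc) (simp_all add: nn_integral_gap_weight[OF q] K_def)
  finally have em: "emeasure lborel D = ennreal K * (\<integral>\<^sup>+u. ennreal (g u) \<partial>lborel)" .
  have "measure lborel D = K * integral\<^sup>L lborel g"
  proof (cases "q = 1")
    case True
    with em show ?thesis
      by (simp add: K_def measure_def)
  next
    case False
    with q g have "\<And>u. 0 \<le> g u" by simp
    moreover have "K \<ge> 0" using q by (simp add: K_def)
    ultimately show ?thesis
      using em int by (simp add: nn_integral_eq_integral measure_def enn2real_mult)
  qed
  then show "measure lborel D =
      (q - 1) / ((real DIM('a) + 2) * (q + real DIM('a) + 1)) * integral\<^sup>L lborel g"
    by (simp add: K_def)
qed

section \<open>Volumes of the two relaxations\<close>

theorem corollary2p6:
  fixes Q :: "(real ^ 'd) set" and f \<mu> :: "real ^ 'd \<Rightarrow> real" and q :: real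
  assumes "polytope Q"
    and "Q \<subseteq> {x. \<forall>i. 0 \<le> x $ i} - {0}"
    and "q \<ge> 1"
    and "homogeneous_on (convex hull (Q \<union> {0})) q f"
    and "convex_on (convex hull (Q \<union> {0})) f"
    and "concave_upper_bound Q f \<mu>"
  shows "vol_difference (naive_relaxation f \<mu> Q) (perspective_relaxation f \<mu> Q) =
    (q - 1) / ((real CARD('d) + 2) * (q + real CARD('d) + 1)) * (LINT x:Q|lebesgue. f x)"
proof -
  let ?S = "convex hull (Q \<union> {0})"
  define C where "C = {(x, y, z). perspective \<mu> x z \<ge> y \<and> y \<ge> perspective f x z \<and>
                x \<in> (*\<^sub>R) z ` Q \<and> 1 \<ge> z \<and> z > 0}"
  define g where "g = (\<lambda>x. indicator (interior Q) x * f x)"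
  define D where "D = {(x, y, z). 0 < z \<and> z \<le> 1 \<and> z powr q * g (x /\<^sub>R z) \<le> y \<and> y < z * g (x /\<^sub>R z)}"
  have convQ: "convex Q" and compactQ: "compact Q"
    using assms(1) by (auto simp: polytope_imp_convex polytope_imp_compact)
  have QS: "Q \<subseteq> ?S"
    by (meson Un_upper1 hull_subset order_trans)
  have convf: "convex_on Q f"
    using assms(5) QS convQ by (rule convex_on_subset)
  have conv\<mu>: "convex_on Q (\<lambda>x. - \<mu> x)" and f\<mu>: "\<And>x. x \<in> Q \<Longrightarrow> f x \<le> \<mu> x"
    using assms(6) by (auto simp: concave_upper_bound_def concave_on_def)
  obtain Bf where Bf: "\<And>x. x \<in> Q \<Longrightarrow> \<bar>f x\<bar> \<le> Bf"
    using convex_on_polytope_bounded[OF assms(1) convf] by blast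
  obtain B\<mu> where B\<mu>: "\<And>x. x \<in> Q \<Longrightarrow> \<bar>\<mu> x\<bar> \<le> B\<mu>"
    using convex_on_polytope_bounded[OF assms(1) conv\<mu>] by auto

  text \<open>On a ray through \<open>u \<in> Q\<close>, homogeneity determines \<open>f\<close> and convexity compares it with its
    perspective. For \<open>q > 1\<close> the comparison forces \<open>f\<close> to be nonnegative on \<open>Q\<close>.\<close>
  have zS: "z *\<^sub>R u \<in> ?S" if "u \<in> Q" "0 \<le> z" "z \<le> 1" for u z
  proof -
    have "z *\<^sub>R u + (1 - z) *\<^sub>R 0 \<in> ?S"
      using that QS by (intro convexD[OF convex_convex_hull]) (auto intro: hull_inc)
    then show ?thesis by simp
  qed
  have f_ray: "f (z *\<^sub>R u) = z powr q * f u" if "u \<in> Q" "0 \<le> z" "z \<le> 1" for u z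
    using assms(4) zS[OF that] that QS unfolding homogeneous_on_def by blast
  have f_0: "f 0 = 0" if "u \<in> Q" for u
    using f_ray[of u 0] that by simp
  have f_le: "z powr q * f u \<le> z * f u" if "u \<in> Q" "0 \<le> z" "z \<le> 1" for u z
  proof -
    have "f ((1 - z) *\<^sub>R 0 + z *\<^sub>R u) \<le> (1 - z) * f 0 + z * f u"
      using that QS by (intro convex_onD[OF assms(5)]) (auto intro: hull_inc)
    then show ?thesis
      using f_ray[OF that] f_0 that by simp
  qed
  have f_nonneg: "0 \<le> f u" if "u \<in> Q" "q > 1" for u
  proof -
    \<comment> \<open>any \<open>z\<close> strictly between 0 and 1 would serve in place of \<open>1/2\<close>\<close>
    have "(1/2) powr q < (1/2) powr (1::real)"
      using that by (intro powr_less_mono') auto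
    then have "(1/2 - (1/2) powr q) > 0" by simp
    moreover have "(1/2 - (1/2) powr q) * f u \<ge> 0"
      using f_le[of u "1/2"] that by (simp add: algebra_simps)
    ultimately show ?thesis
      by (simp add: zero_le_mult_iff)
  qed

  text \<open>A convex function need be continuous only in the interior of \<open>Q\<close>. The Borel function \<open>g\<close>
    therefore discards the values of \<open>f\<close> on the frontier, which is negligible.\<close>
  have frontierQ: "negligible (frontier Q)"
    using convQ by (rule negligible_convex_frontier)
  have "continuous_on (interior Q) f"
    using convf convQ interior_subset
    by (intro convex_on_continuous) (auto intro: convex_on_subset convex_interior)
  then have g_meas [measurable]: "g \<in> borel_measurable borel"
    unfolding g_def
    using borel_measurable_continuous_on_indicator[of "interior Q" f] by simp
  have g_bound: "norm (g x) \<le> indicator Q x * \<bar>Bf\<bar>" for x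
    using Bf[of x] interior_subset[of Q] by (auto simp: g_def indicator_def)
  have g_int: "integrable lborel g"
  proof (rule Bochner_Integration.integrable_bound)
    show "integrable lborel (\<lambda>x. indicator Q x * \<bar>Bf\<bar>)"
      using compactQ emeasure_compact_finite[OF compactQ]
      by (intro integrable_mult_left)
        (auto simp: integrable_indicator_iff compact_imp_closed borel_closed)
    show "AE x in lborel. norm (g x) \<le> norm (indicator Q x * \<bar>Bf\<bar>)"
      using g_bound by (auto simp: abs_mult)
  qed simp
  have "(LINT x:Q|lebesgue. f x) = integral\<^sup>L lebesgue g"
    unfolding set_lebesgue_integral_def
  proof (rule integral_cong_AE)
    have "AE x in lebesgue. x \<notin> frontier Q"
      using frontierQ by (intro AE_not_in) (simp add: negligible_iff_null_sets)
    then show eq: "AE x in lebesgue. indicator Q x *\<^sub>R f x = g x"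
      by eventually_elim
        (use interior_subset[of Q] closure_subset[of Q] in \<open>auto simp: g_def indicator_def frontier_def\<close>)
    show gl: "g \<in> borel_measurable lebesgue"
      using g_meas by (simp add: measurable_completion)
    show "(\<lambda>x. indicator Q x *\<^sub>R f x) \<in> borel_measurable lebesgue"
      using gl by (rule borel_measurable_AE) (use eq in eventually_elim, simp)
  qed
  also have "\<dots> = integral\<^sup>L lborel g"
    by (rule integral_completion) simp
  finally have int_g: "(LINT x:Q|lebesgue. f x) = integral\<^sup>L lborel g" .

  text \<open>The set \<open>C\<close> is convex, as the intersection of the perspective epigraph of \<open>f\<close>, the reflected
    perspective epigraph of \<open>- \<mu>\<close>, and a half-space. Both \<open>C\<close> and \<open>D\<close> are bounded.\<close>
  have "convex C"
  proof -
    let ?E = "\<lambda>h. {(x, y, z). 0 < z \<and> x \<in> (*\<^sub>R) z ` Q \<and> perspective h x z \<le> y}"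
    have "linear (\<lambda>(x::real^'d, y::real, z::real). (x, - y, z))"
      by (rule linearI) auto
    then have "convex ((\<lambda>(x, y, z). (x, - y, z)) -` ?E (\<lambda>x. - \<mu> x))"
      using convex_perspective_epigraph[OF conv\<mu>] by (rule convex_linear_vimage)
    moreover have "convex ((UNIV :: (real^'d) set) \<times> (UNIV :: real set) \<times> {..1::real})"
      by (intro convex_Times) auto
    moreover have "C = ?E f \<inter> ((\<lambda>(x, y, z). (x, - y, z)) -` ?E (\<lambda>x. - \<mu> x)) \<inter> (UNIV \<times> UNIV \<times> {..1})"
      by (auto simp: C_def perspective_def)
    ultimately show ?thesis
      using convex_perspective_epigraph[OF convf] by (simp add: convex_Int)
  qed
  define Box where "Box = ?S \<times> {- (Bf + B\<mu>)..Bf + B\<mu>} \<times> {0..1::real}"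
  have "bounded Box"
    unfolding Box_def using compactQ
    by (intro bounded_Times bounded_convex_hull) (auto simp: compact_imp_bounded)
  have small: "\<bar>z * h u\<bar> \<le> B" if "\<bar>h u\<bar> \<le> B" "0 \<le> z" "z \<le> 1" for z B :: real and h :: "real^'d \<Rightarrow> real" and u
    using mult_mono[of z 1 "\<bar>h u\<bar>" B] that by (simp add: abs_mult)
  have "C \<subseteq> Box"
  proof
    fix p assume "p \<in> C"
    then obtain u y z where p: "p = (z *\<^sub>R u, y, z)" "u \<in> Q" "0 < z" "z \<le> 1" "y \<le> z * \<mu> u" "z * f u \<le> y"
      by (auto simp: C_def perspective_def)
    then show "p \<in> Box"
      using small[of \<mu> u B\<mu> z] small[of f u Bf z] B\<mu>[of u] Bf[of u] zS[of u z]
      by (auto simp: Box_def abs_le_iff)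
  qed
  \<comment> \<open>If \<open>g (x /\<^sub>R z) = 0\<close>, the bounds on \<open>y\<close> in \<open>D\<close> are contradictory; hence \<open>x /\<^sub>R z\<close> is an
    interior point of \<open>Q\<close>.\<close>
  have D_dest: "\<exists>u\<in>interior Q. p = (z *\<^sub>R u, y, z) \<and> 0 < z \<and> z \<le> 1 \<and> z powr q * f u \<le> y \<and> y < z * f u"
    if "p \<in> D" "p = (x, y, z)" for p x y z
  proof -
    from that have *: "0 < z" "z \<le> 1" "z powr q * g (x /\<^sub>R z) \<le> y" "y < z * g (x /\<^sub>R z)"
      by (auto simp: D_def)
    have "x /\<^sub>R z \<in> interior Q"
      using * by (cases "x /\<^sub>R z \<in> interior Q") (auto simp: g_def)
    then show ?thesis
      using * that(2) by (intro bexI[of _ "x /\<^sub>R z"]) (auto simp: g_def)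
  qed
  have "D \<subseteq> Box"
  proof
    fix p assume "p \<in> D"
    obtain x y z where "p = (x, y, z)" by (cases p)
    from D_dest[OF \<open>p \<in> D\<close> this] obtain u where
      p: "p = (z *\<^sub>R u, y, z)" "u \<in> Q" "0 < z" "z \<le> 1" "z powr q * f u \<le> y" "y < z * f u"
      using interior_subset by blast
    have "z powr q \<le> 1"
      using p assms(3) powr_mono'[of 0 q z] by simp
    then show "p \<in> Box"
      using p small[of f u Bf "z powr q"] small[of f u Bf z] Bf[of u] B\<mu>[of u] zS[of u z]
      by (auto simp: Box_def abs_le_iff)
  qed
  have C_meas: "C \<in> lmeasurable"
    using \<open>convex C\<close> bounded_subset[OF \<open>bounded Box\<close> \<open>C \<subseteq> Box\<close>] by (rule measurable_convex)
  note D_gap = measure_perspective_gap[OF g_meas g_int assms(3), folded D_def]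
  have g_nonneg: "0 \<le> g u" if "q > 1" for u
    using f_nonneg[of u] that interior_subset[of Q] by (auto simp: g_def indicator_def)
  have D_borel: "D \<in> sets borel"
    using g_nonneg by (rule D_gap(1))
  then have D_meas: "D \<in> lmeasurable"
    using bounded_subset[OF \<open>bounded Box\<close> \<open>D \<subseteq> Box\<close>]
    by (intro bounded_set_imp_lmeasurable) auto

  have "measure lebesgue (perspective_relaxation f \<mu> Q) = measure lebesgue C"
  proof -
    have eq: "perspective_relaxation f \<mu> Q = closure C"
      using \<open>convex C\<close> by (simp add: perspective_relaxation_def C_def hull_same)
    have "negligible (C - closure C \<union> (closure C - C))"
      using negligible_convex_frontier[OF \<open>convex C\<close>]
      by (rule negligible_subset)
        (use closure_subset[of C] interior_subset[of C] in \<open>auto simp: frontier_def\<close>)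
    then show ?thesis
      unfolding eq by (rule measure_negligible_symdiff[OF C_meas])
  qed
  \<comment> \<open>The two sets differ only where \<open>z = 0\<close> or where \<open>x /\<^sub>R z\<close> is on the frontier of \<open>Q\<close>.\<close>
  moreover have "measure lebesgue (naive_relaxation f \<mu> Q) = measure lebesgue (C \<union> D)"
  proof (rule measure_negligible_symdiff)
    show "C \<union> D \<in> lmeasurable"
      using C_meas D_meas by (rule fmeasurable.Un)
    let ?P0 = "naive_relaxation f \<mu> Q"
    let ?N = "{(x, y::real, z::real). 0 < z \<and> x /\<^sub>R z \<in> frontier Q}"
    \<comment> \<open>the hyperplane \<open>z = 0\<close>\<close>
    let ?H = "{p::(real^'d) \<times> real \<times> real. (0, 0, 1) \<bullet> p = 0}"
    have "p \<in> ?P0" if "p \<in> C" for p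
    proof -
      obtain u y z where p: "p = (z *\<^sub>R u, y, z)" "u \<in> Q" "0 < z" "z \<le> 1" "y \<le> z * \<mu> u" "z * f u \<le> y"
        using \<open>p \<in> C\<close> by (auto simp: C_def perspective_def)
      then show ?thesis
        using f_le[of u z] f_ray[of u z] by (auto simp: naive_relaxation_def perspective_def)
    qed
    moreover have "p \<in> ?P0" if "p \<in> D" for p
    proof -
      obtain x y z where "p = (x, y, z)" by (cases p)
      from D_dest[OF \<open>p \<in> D\<close> this] obtain u where
        p: "p = (z *\<^sub>R u, y, z)" "u \<in> Q" "0 < z" "z \<le> 1" "z powr q * f u \<le> y" "y < z * f u"
        using interior_subset by blast
      have "z * f u \<le> z * \<mu> u"
        using p f\<mu> by simp
      then have "y \<le> z * \<mu> u"
        using p by linarith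
      with p show ?thesis
        using f_ray[of u z] by (auto simp: naive_relaxation_def perspective_def)
    qed
    moreover have "p \<in> ?N \<union> ?H" if "p \<in> ?P0" "p \<notin> C" "p \<notin> D" for p
    proof -
      obtain u y z where p: "p = (z *\<^sub>R u, y, z)" "u \<in> Q" "0 \<le> z" "z \<le> 1"
        "y \<le> perspective \<mu> (z *\<^sub>R u) z" "f (z *\<^sub>R u) \<le> y"
        using \<open>p \<in> ?P0\<close> by (auto simp: naive_relaxation_def)
      show ?thesis
      proof (cases "z = 0")
        case True
        then show ?thesis using p by simp
      next
        case False
        then have "0 < z" using p by simp
        have y: "y < z * f u"
        proof (rule ccontr)
          assume "\<not> y < z * f u"
          then have "p \<in> C"
            using p \<open>0 < z\<close> by (auto simp: C_def perspective_def)
          with that show False by simp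
        qed
        have "u \<notin> interior Q"
        proof
          assume "u \<in> interior Q"
          then have "p \<in> D"
            using p \<open>0 < z\<close> y f_ray[of u z] by (auto simp: D_def g_def)
          with that show False by simp
        qed
        then have "u \<in> frontier Q"
          using p(2) closure_subset[of Q] by (auto simp: frontier_def)
        then show ?thesis
          using p \<open>0 < z\<close> by auto
      qed
    qed
    ultimately have "(C \<union> D) - ?P0 \<union> (?P0 - (C \<union> D)) \<subseteq> ?N \<union> ?H"
      by blast
    moreover have "negligible (?N \<union> ?H)"
      using negligible_cone_over[OF frontier_closed frontierQ]
      by (intro negligible_Un negligible_hyperplane) (auto simp: zero_prod_def)
    ultimately show "negligible ((C \<union> D) - ?P0 \<union> (?P0 - (C \<union> D)))"
      by (rule negligible_subset[rotated])
  qed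
  moreover have "measure lebesgue (C \<union> D) = measure lebesgue C + measure lebesgue D"
  proof (rule measure_Union)
    have False if "p \<in> C" "p \<in> D" for p
    proof -
      obtain x y z where p: "p = (x, y, z)" by (cases p)
      then show False
        using D_dest[OF \<open>p \<in> D\<close> p] \<open>p \<in> C\<close> by (auto simp: C_def perspective_def)
    qed
    then show "C \<inter> D = {}" by blast
  qed (use fmeasurableD[OF C_meas] fmeasurableD[OF D_meas] fmeasurableD2[OF C_meas] fmeasurableD2[OF D_meas] in
      \<open>simp_all only: infinity_ennreal_def not_False_eq_True\<close>)
  moreover have "measure lebesgue D = measure lborel D"
    using D_borel by simp
  ultimately show ?thesis
    unfolding vol_difference_def int_g using D_gap(2) g_nonneg by simp
qed

end
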